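(* Fix $\beta\in(0,1)$ and choose $\beta_i>0$, $i\in\mathcal N$, such that $\sum_{i\in\mathcal N}\beta_i=\beta$. For each $i\in\mathcal N$ set $$\epsilon_i(s)=1-\left(\frac{\beta_i}{(N+1)\binom{K_i}{s}}\right)^{\frac{1}{K_i-s}}\quad (0\le s<K_i),\qquad \epsilon_i(K_i)=1 ,$$ and let $$\epsilon^\ast=\max\Bigl\{\sum_{i\in\mathcal N}\epsilon_i(s_i)\ :\ \sum_{i\in\mathcal N}s_i\le N,\ s_i\in\{0,1,\dots,K_i\}\Bigr\}.$$ Let $\boldsymbol x^\ast$ be the unique allocation in $C(G_K)$ minimising a given convex function $f:\mathbb R^N\to\mathbb R$ over $C(G_K)$. Then $$\mathbb P^K\Bigl\{\boldsymbol\xi\in\Xi^K:\ \mathbb P\bigl\{\xi\in\Xi:\ \exists\,S\subset\mathcal N,\ \textstyle\sum_{i\in S}x_i^\ast<u_S(\xi)\bigr\}\le\epsilon^\ast\Bigr\}\ \ge\ 1-\beta .$$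
   Context: Setting. $\mathcal N=\{1,\dots,N\}$ is the set of agents. $\Xi$ is the uncertainty set, endowed with an (unknown) probability measure $\mathbb P$. For every nonempty coalition $S\subset\mathcal N$ (throughout, $\subset$ denotes proper inclusion, so $S\neq\mathcal N$) there is a value function $u_S:\Xi\to\mathbb R$; the value of the grand coalition is a deterministic number $u_{\mathcal N}\in\mathbb R$. An allocation is a vector $\boldsymbol x=(x_i)_{i\in\mathcal N}\in\mathbb R^N$. Private sampling. Each agent $i$ draws $\boldsymbol\xi_i=(\xi_i^{(1)},\dots,\xi_i^{(K_i)})\in\Xi^{K_i}$, consisting of $K_i$ independent samples from $\mathbb P$; samples of different agents are independent. Put $K=\sum_{i\in\mathcal N}K_i$; $\boldsymbol\xi=(\boldsymbol\xi_i)_{i\in\mathcal N}$ has law $\mathbb P^K$ (the $K$-fold product measure) on $\Xi^K$. Scenario core with private sampling: $$C(G_K)=\Bigl\{\boldsymbol x\in\mathbb R^N:\ \sum_{i\in\mathcal N}x_i=u_{\mathcal N}\ \text{ and }\ \sum_{i\in S}x_i\ge\max_{i\in S}\max_{k=1,\dots,K_i}u_S(\xi_i^{(k)})\ \ \forall S\subset\mathcal N\Bigr\}.$$ Standing assumption: $C(G_K)$ is nonempty for every $\boldsymbol\xi\in\Xi^K$. Uniqueness of the minimiser: $\boldsymbol x^\ast=\arg\min_{\boldsymbol x\in C(G_K)}f(\boldsymbol x)$ is unique; if several minimisers are possible, a fixed convex tie-break rule is applied to single out one (the same rule is used for the program restricted to any subset of the samples). *)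

theory Defs
  imports "HOL-Probability.Probability"
begin

text \<open>
  The agents are the elements of a finite type \<open>'n\<close>, so \<open>N = CARD('n)\<close> and allocations are
  vectors in \<open>real ^ 'n\<close>. The uncertainty set is \<open>space P\<close>. A multisample is a
  function on the pairs \<open>(i, k)\<close> with \<open>1 \<le> k \<le> K i\<close>.
\<close>

definition coalitions :: "'n::finite set set" where
  "coalitions = {S. S \<noteq> {} \<and> S \<subset> UNIV}"

definition multisample :: "'a measure \<Rightarrow> ('n::finite \<Rightarrow> nat) \<Rightarrow> ('n \<times> nat \<Rightarrow> 'a) measure" where
  "multisample P K = (\<Pi>\<^sub>M j\<in>(SIGMA i:UNIV. {1..K i}). P)"

text \<open>\<open>Max\<close> is unspecified on the empty set, so this is meaningful only if every \<open>K i\<close> is positive.\<close>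

definition scenario_core ::
  "('n::finite set \<Rightarrow> 'a \<Rightarrow> real) \<Rightarrow> real \<Rightarrow> ('n \<Rightarrow> nat) \<Rightarrow> ('n \<times> nat \<Rightarrow> 'a) \<Rightarrow> (real ^ 'n) set" where
  "scenario_core u uN K \<xi> =
    {x. (\<Sum>i\<in>UNIV. x $ i) = uN \<and>
        (\<forall>S\<in>coalitions. (\<Sum>i\<in>S. x $ i) \<ge> (MAX i\<in>S. MAX k\<in>{1..K i}. u S (\<xi> (i, k))))}"

text \<open>
  A convex tie-break rule is a finite list of convex functions, minimised one after the other:
  each one over the set of minimisers left by its predecessors. The empty list means that
  no tie-break is applied.
\<close>

primrec tie_break :: "('b \<Rightarrow> real) list \<Rightarrow> 'b set \<Rightarrow> 'b set" where
  "tie_break [] A = A"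
| "tie_break (t # ts) A = tie_break ts {x. is_arg_min t (\<lambda>y. y \<in> A) x}"

definition minimisers :: "('b \<Rightarrow> real) \<Rightarrow> ('b \<Rightarrow> real) list \<Rightarrow> 'b set \<Rightarrow> 'b set" where
  "minimisers f ts A = tie_break ts {x. is_arg_min f (\<lambda>y. y \<in> A) x}"

definition violation ::
  "'a measure \<Rightarrow> ('n::finite set \<Rightarrow> 'a \<Rightarrow> real) \<Rightarrow> real ^ 'n \<Rightarrow> real" where
  "violation P u x = measure P {\<xi> \<in> space P. \<exists>S\<in>coalitions. (\<Sum>i\<in>S. x $ i) < u S \<xi>}"

text \<open>\<open>eps n b k s\<close> is the level of an agent with \<open>k\<close> samples and confidence
  parameter \<open>b\<close>, in a game with \<open>n\<close> agents.\<close>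

definition eps :: "nat \<Rightarrow> real \<Rightarrow> nat \<Rightarrow> nat \<Rightarrow> real" where
  "eps n b k s =
    (if s < k then 1 - (b / (real (n + 1) * real (k choose s))) powr (1 / real (k - s)) else 1)"

definition eps_star :: "('n::finite \<Rightarrow> real) \<Rightarrow> ('n \<Rightarrow> nat) \<Rightarrow> real" where
  "eps_star \<beta>s K =
    Max {(\<Sum>i\<in>UNIV. eps CARD('n) (\<beta>s i) (K i) (s i)) | s :: 'n \<Rightarrow> nat.
          (\<Sum>i\<in>UNIV. s i) \<le> CARD('n) \<and> (\<forall>i. s i \<le> K i)}"

end

theory Submission
  imports Defs
begin

text \<open>
  Every sample of agent \<open>i\<close> cuts out a convex set of allocations. The allocations lexicographically
  better than \<open>x\<^sup>*\<close> form a convex set too, so by Helly's theorem at most \<open>N\<close> samples, say \<open>s\<^sub>i\<close>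
  of agent \<open>i\<close>, already make \<open>x\<^sup>*\<close> optimal. For fixed \<open>i\<close>, retain those \<open>s\<^sub>i\<close> samples and all
  samples of the other agents: \<open>x\<^sup>*\<close> is then independent of the \<open>K\<^sub>i - s\<^sub>i\<close> discarded samples, yet
  they all accept it, which has probability at most \<open>(1 - \<epsilon>)\<close> to the power \<open>K\<^sub>i - s\<^sub>i\<close> if the
  coalitions containing \<open>i\<close> violate \<open>x\<^sup>*\<close> with probability above \<open>\<epsilon>\<close>. A union bound over the
  retained subsets gives \<open>\<beta>\<^sub>i\<close>, and a violating coalition contains some agent.

  An agent may retain no sample at all, and then the reduced program may lack a minimiser or
  have several; a final strictly convex criterion restores uniqueness.
\<close>

section \<open>Lexicographic minimisation\<close>

text \<open>Iterated minimisation becomes minimality for one strict relation, so that all points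
  beating a given one form a single set, to which convexity and Helly's theorem apply.\<close>

primrec lex_less :: "('b \<Rightarrow> real) list \<Rightarrow> 'b \<Rightarrow> 'b \<Rightarrow> bool" where
  "lex_less [] y x \<longleftrightarrow> False"
| "lex_less (t # ts) y x \<longleftrightarrow> t y < t x \<or> t y = t x \<and> lex_less ts y x"

lemma tie_break_eq_lex: "tie_break ts A = {x \<in> A. \<forall>y\<in>A. \<not> lex_less ts y x}"
proof (induction ts arbitrary: A)
  case (Cons t ts)
  show ?case
    unfolding tie_break.simps Cons.IH
    by (auto simp: is_arg_min_def) (metis linorder_less_linear)+
qed simp

lemma tie_break_antimono: "x \<in> tie_break ts B \<Longrightarrow> A \<subseteq> B \<Longrightarrow> x \<in> A \<Longrightarrow> x \<in> tie_break ts A"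
  unfolding tie_break_eq_lex by blast

lemma tie_break_append: "tie_break (ts @ ts') A = tie_break ts' (tie_break ts A)"
  by (induction ts arbitrary: A) auto

text \<open>If both points tie with \<open>x\<close> in the first criterion, convexity gives either
  a strict gain or another tie, and induction settles the tie. If one of them is strictly better,
  positivity of both weights keeps the combination strictly better.\<close>

lemma lex_less_convex_comb:
  assumes "\<And>t. t \<in> set ts \<Longrightarrow> convex_on UNIV t"
    and "lex_less ts y x" "lex_less ts z x" "a > 0" "b > 0" "a + b = (1::real)"
  shows "lex_less ts (a *\<^sub>R y + b *\<^sub>R z) x"
  using assms(1-3)
proof (induction ts)
  case (Cons t ts)
  have le: "t y \<le> t x" "t z \<le> t x" using Cons.prems by auto
  have cx: "t (a *\<^sub>R y + b *\<^sub>R z) \<le> a * t y + b * t z"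
    using Cons.prems(1)[of t] assms(4-6) by (auto simp: convex_on_def)
  have tx: "a * t x + b * t x = t x"
    using assms(6) by (metis distrib_right mult_1)
  show ?case
  proof (cases "t y = t x \<and> t z = t x")
    case True
    then show ?thesis using Cons cx tx by auto
  next
    case False
    then have "t y < t x \<and> t z \<le> t x \<or> t y \<le> t x \<and> t z < t x" using le by auto
    then have "a * t y + b * t z < a * t x + b * t x"
      using assms(4,5) by (auto intro: add_less_le_mono add_le_less_mono)
    then show ?thesis using cx tx by auto
  qed
qed simp

lemma convex_lex_less:
  fixes x :: "'b::real_vector"
  assumes "\<And>t. t \<in> set ts \<Longrightarrow> convex_on UNIV t"
  shows "convex {y. lex_less ts y x}"
proof (rule convexI)
  fix y z :: 'b and a b :: real
  assume *: "y \<in> {y. lex_less ts y x}" "z \<in> {y. lex_less ts y x}" "0 \<le> a" "0 \<le> b" "a + b = 1"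
  then consider "a = 0" "b = 1" | "a = 1" "b = 0" | "a > 0" "b > 0" by fastforce
  then show "a *\<^sub>R y + b *\<^sub>R z \<in> {y. lex_less ts y x}"
    using lex_less_convex_comb[OF assms] * by cases auto
qed

text \<open>The gap in the convexity inequality equals a(1-a) times the squared distance of
  \<open>x\<close> and \<open>y\<close>.\<close>

lemma convex_on_inner_self: "convex_on UNIV (\<lambda>z :: 'b::real_inner. z \<bullet> z)"
proof (rule convex_onI)
  fix a :: real and x y :: 'b
  assume "0 < a" "a < 1"
  then have "0 \<le> a * (1 - a) * ((x - y) \<bullet> (x - y))" by simp
  also have "\<dots> = (1 - a) * (x \<bullet> x) + a * (y \<bullet> y)
      - ((1 - a) *\<^sub>R x + a *\<^sub>R y) \<bullet> ((1 - a) *\<^sub>R x + a *\<^sub>R y)"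
    by (simp add: inner_add_left inner_add_right inner_diff_left inner_diff_right inner_commute
        algebra_simps)
  finally show "((1 - a) *\<^sub>R x + a *\<^sub>R y) \<bullet> ((1 - a) *\<^sub>R x + a *\<^sub>R y)
      \<le> (1 - a) * (x \<bullet> x) + a * (y \<bullet> y)" by simp
qed simp

text \<open>Parallelogram law: the squared norm of the midpoint is the mean of the two squared norms
  minus a quarter of the squared distance.\<close>

lemma inner_self_midpoint_less:
  fixes x y :: "'b::real_inner"
  assumes "x \<noteq> y" "y \<bullet> y \<le> x \<bullet> x"
  shows "((1/2) *\<^sub>R x + (1/2) *\<^sub>R y) \<bullet> ((1/2) *\<^sub>R x + (1/2) *\<^sub>R y) < x \<bullet> x"
proof -
  have "0 < (x - y) \<bullet> (x - y)" using assms(1) by simp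
  then show ?thesis using assms(2)
    by (simp add: inner_add_left inner_add_right inner_diff_left inner_diff_right inner_commute
        field_simps)
qed

text \<open>At the first criterion that separates the points, \<open>y\<close> is strictly better,
  and by convexity so is the midpoint. If no criterion in \<open>ts\<close> separates them, the
  midpoint is nowhere worse and the squared norm decides.\<close>

lemma lex_less_midpoint:
  fixes x y :: "'b::real_inner"
  assumes "\<And>t. t \<in> set ts \<Longrightarrow> convex_on UNIV t" "x \<noteq> y"
    and "\<not> lex_less (ts @ [\<lambda>z. z \<bullet> z]) x y"
  shows "lex_less (ts @ [\<lambda>z. z \<bullet> z]) ((1/2) *\<^sub>R x + (1/2) *\<^sub>R y) x"
  using assms(1,3)
proof (induction ts)
  case Nil
  then show ?case using inner_self_midpoint_less[OF assms(2)] by simp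
next
  case (Cons t ts)
  have "t y \<le> t x" using Cons.prems(2) by auto
  have cx: "t ((1/2) *\<^sub>R x + (1/2) *\<^sub>R y) \<le> 1/2 * t x + 1/2 * t y"
    using convex_onD[OF Cons.prems(1)[of t], of "1/2" x y] by simp
  show ?case
  proof (cases "t y = t x")
    case True
    then show ?thesis using Cons cx by fastforce
  next
    case False
    then have "t ((1/2) *\<^sub>R x + (1/2) *\<^sub>R y) < t x"
      using cx \<open>t y \<le> t x\<close> by (simp add: field_simps)
    then show ?thesis by simp
  qed
qed

text \<open>Appending a strictly convex criterion makes a minimiser unique over any convex set, in
  particular for programs with fewer constraints than the one assumed to have a unique solution.\<close>

lemma tie_break_unique:
  fixes x y :: "'b::real_inner"
  assumes "\<And>t. t \<in> set ts \<Longrightarrow> convex_on UNIV t" "convex A"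
    and "x \<in> tie_break (ts @ [\<lambda>z. z \<bullet> z]) A" "y \<in> tie_break (ts @ [\<lambda>z. z \<bullet> z]) A"
  shows "x = y"
proof (rule ccontr)
  assume "x \<noteq> y"
  let ?z = "(1/2) *\<^sub>R x + (1/2) *\<^sub>R y"
  have A: "x \<in> A" "y \<in> A" and "\<not> lex_less (ts @ [\<lambda>z. z \<bullet> z]) x y"
    using assms(3,4) unfolding tie_break_eq_lex by auto
  then have "lex_less (ts @ [\<lambda>z. z \<bullet> z]) ?z x"
    using lex_less_midpoint[OF assms(1) \<open>x \<noteq> y\<close>] by blast
  moreover have "?z \<in> A" using convexD[OF assms(2) A, of "1/2" "1/2"] by simp
  ultimately show False using assms(3) unfolding tie_break_eq_lex by blast
qed

section \<open>Helly's theorem and support constraints\<close>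

lemma Helly_obtain:
  fixes \<F> :: "'b::euclidean_space set set"
  assumes "finite \<F>" "\<And>S. S \<in> \<F> \<Longrightarrow> convex S" "\<Inter>\<F> = {}"
  obtains T where "T \<subseteq> \<F>" "card T \<le> DIM('b) + 1" "\<Inter>T = {}"
proof (cases "card \<F> \<ge> DIM('b) + 1")
  case True
  then show ?thesis using Helly[of \<F>] assms that by (metis order_refl)
next
  case False
  then show ?thesis using assms that[of \<F>] by auto
qed

text \<open>The points beating the minimiser form one convex set, so Helly's theorem leaves at most
  \<open>DIM('b)\<close> of the constraints.\<close>

lemma tie_break_support:
  fixes C0 :: "'b::euclidean_space set"
  assumes "\<And>t. t \<in> set ts \<Longrightarrow> convex_on UNIV t" "convex C0" "finite I"
    and "\<And>j. j \<in> I \<Longrightarrow> convex (H j)"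
    and x: "x \<in> tie_break ts (C0 \<inter> (\<Inter>j\<in>I. H j))"
  obtains J where "J \<subseteq> I" "card J \<le> DIM('b)" "x \<in> tie_break ts (C0 \<inter> (\<Inter>j\<in>J. H j))"
proof -
  define L where "L = C0 \<inter> {y. lex_less ts y x}"
  have xC: "x \<in> C0" "\<And>j. j \<in> I \<Longrightarrow> x \<in> H j"
    and min: "\<And>y. y \<in> C0 \<Longrightarrow> \<forall>j\<in>I. y \<in> H j \<Longrightarrow> \<not> lex_less ts y x"
    using x unfolding tie_break_eq_lex by auto
  have "convex L" unfolding L_def by (intro convex_Int assms convex_lex_less)
  moreover have "\<Inter>(insert L (H ` I)) = {}" using min by (auto simp: L_def)
  ultimately obtain T where T: "T \<subseteq> insert L (H ` I)" "card T \<le> DIM('b) + 1" "\<Inter>T = {}"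
    using Helly_obtain[of "insert L (H ` I)"] assms(3,4) by blast
  have finT: "finite T" using T(1) assms(3) finite_subset by blast
  \<comment> \<open>The constraints alone have \<open>x\<close> in common, so an empty intersection
    must involve \<open>L\<close>. This uses up one of the DIM + 1 sets and leaves DIM for the
    constraints.\<close>
  have "L \<in> T"
  proof (rule ccontr)
    assume "L \<notin> T"
    then have "x \<in> \<Inter>T" using T(1) xC(2) by blast
    then show False using T(3) by simp
  qed
  have "T - {L} \<subseteq> H ` I" using T(1) by blast
  \<comment> \<open>Different indices may give the same set; one index per set keeps the cardinality
    bound.\<close>
  then obtain J where J: "J \<subseteq> I" "inj_on H J" "T - {L} = H ` J"
    unfolding subset_image_inj by blast
  have "card J = card (T - {L})" using J(2,3) by (simp add: card_image)
  then have "card J \<le> DIM('b)" using T(2) \<open>L \<in> T\<close> finT by simp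
  moreover have "x \<in> tie_break ts (C0 \<inter> (\<Inter>j\<in>J. H j))"
  proof -
    have "L \<inter> (\<Inter>j\<in>J. H j) = {}" using T(3) J(3) \<open>L \<in> T\<close> by blast
    then show ?thesis unfolding tie_break_eq_lex L_def using xC J(1) by blast
  qed
  ultimately show ?thesis using that J(1) by blast
qed

section \<open>Measurability of lexicographic minimisers\<close>

text \<open>The uncountable choice of \<open>x\<close> is replaced by a countable one: feasibility
  holds iff for every \<open>n\<close> some point of a dense set \<open>D\<close> is feasible up to
  a slack 1/(n+1). Continuity and density give one direction, compactness the other.\<close>

lemma measurable_feasible_compact:
  fixes F :: "'b::{metric_space, second_countable_topology} set"
  assumes "compact F" "finite L" "\<And>h c. (h, c) \<in> L \<Longrightarrow> continuous_on UNIV h"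
    and "\<And>h c. (h, c) \<in> L \<Longrightarrow> c \<in> borel_measurable M"
  shows "{\<xi> \<in> space M. \<exists>x\<in>F. \<forall>(h, c)\<in>L. ereal (h x) \<le> c \<xi>} \<in> sets M"
proof -
  obtain D where D: "countable D" "D \<subseteq> F" "F \<subseteq> closure D" using separable by blast
  have "(\<exists>x\<in>F. \<forall>(h, c)\<in>L. ereal (h x) \<le> c \<xi>) \<longleftrightarrow>
    (\<forall>n::nat. \<exists>x\<in>D. \<forall>(h, c)\<in>L. ereal (h x - 1 / Suc n) < c \<xi>)" for \<xi>
  proof
    assume "\<exists>x\<in>F. \<forall>(h, c)\<in>L. ereal (h x) \<le> c \<xi>"
    then obtain x where x: "x \<in> F" "\<And>h c. (h, c) \<in> L \<Longrightarrow> ereal (h x) \<le> c \<xi>" by blast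
    show "\<forall>n::nat. \<exists>x\<in>D. \<forall>(h, c)\<in>L. ereal (h x - 1 / Suc n) < c \<xi>"
    proof
      fix n :: nat
      define U where "U = (\<Inter>(h, c)\<in>L. {y. h y < h x + 1 / Suc n})"
      have "open U" unfolding U_def using assms(2,3)
        by (auto intro!: open_INT open_Collect_less continuous_intros)
      moreover have "x \<in> U" by (auto simp: U_def)
      moreover have "x \<in> closure D" using x(1) D(3) by blast
      ultimately obtain y where y: "y \<in> D" "y \<in> U"
        using open_Int_closure_eq_empty[of U D] by blast
      have "ereal (h y - 1 / Suc n) < c \<xi>" if "(h, c) \<in> L" for h c
      proof -
        have "h y - 1 / Suc n < h x" using y(2) that by (fastforce simp: U_def)
        then show ?thesis using x(2)[OF that] by (metis less_ereal.simps(1) order_less_le_trans)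
      qed
      then show "\<exists>x\<in>D. \<forall>(h, c)\<in>L. ereal (h x - 1 / Suc n) < c \<xi>" using y(1) by blast
    qed
  next
    assume "\<forall>n::nat. \<exists>x\<in>D. \<forall>(h, c)\<in>L. ereal (h x - 1 / Suc n) < c \<xi>"
    then obtain y where y: "\<And>n. y n \<in> D"
        "\<And>n h c. (h, c) \<in> L \<Longrightarrow> ereal (h (y n) - 1 / Suc n) < c \<xi>"
      by (metis (no_types, lifting) case_prodD)
    \<comment> \<open>A limit of almost feasible points is feasible, since the slack vanishes along
      the subsequence.\<close>
    have "\<forall>n. y n \<in> F" using y(1) D(2) by blast
    then obtain x r where x: "x \<in> F" "strict_mono r" "(y \<circ> r) \<longlonglongrightarrow> x"
      using assms(1) unfolding compact_def by metis
    have "ereal (h x) \<le> c \<xi>" if hc: "(h, c) \<in> L" for h c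
    proof -
      have "(\<lambda>n. h ((y \<circ> r) n)) \<longlonglongrightarrow> h x"
        using continuous_on_tendsto_compose[OF assms(3)[OF hc] x(3)] by simp
      moreover have "(\<lambda>n. 1 / Suc (r n)) \<longlonglongrightarrow> 0"
        using LIMSEQ_subseq_LIMSEQ[OF lim_1_over_n[THEN LIMSEQ_Suc] x(2)] by (simp add: comp_def)
      ultimately have "(\<lambda>n. h ((y \<circ> r) n) - 1 / Suc (r n)) \<longlonglongrightarrow> h x - 0"
        by (rule tendsto_diff)
      then have "(\<lambda>n. ereal (h ((y \<circ> r) n) - 1 / Suc (r n))) \<longlonglongrightarrow> ereal (h x)" by simp
      then show ?thesis
        by (rule LIMSEQ_le_const2) (use y(2)[OF hc] in \<open>auto intro!: less_imp_le exI[of _ 0]\<close>)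
    qed
    then show "\<exists>x\<in>F. \<forall>(h, c)\<in>L. ereal (h x) \<le> c \<xi>" using x(1) by blast
  qed
  moreover have "{\<xi> \<in> space M. \<forall>n::nat. \<exists>x\<in>D. \<forall>(h, c)\<in>L. ereal (h x - 1 / Suc n) < c \<xi>} \<in> sets M"
  proof -
    have "{\<xi> \<in> space M. \<forall>hc\<in>L. ereal (fst hc x - 1 / Suc n) < snd hc \<xi>} \<in> sets M" for x and n :: nat
      using assms(2,4) by (intro sets.sets_Collect_finite_All) (auto intro!: borel_measurable_less)
    then show ?thesis using D(1)
      by (intro sets.sets_Collect_countable_All sets.sets_Collect_countable_Ex')
        (auto simp: case_prod_beta)
  qed
  ultimately show ?thesis by simp
qed

text \<open>A closed set is the countable union of its compact pieces in balls of integer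
  radius.\<close>

lemma measurable_feasible:
  fixes F :: "'b::euclidean_space set"
  assumes "closed F" "finite L" "\<And>h c. (h, c) \<in> L \<Longrightarrow> continuous_on UNIV h"
    and "\<And>h c. (h, c) \<in> L \<Longrightarrow> c \<in> borel_measurable M"
  shows "{\<xi> \<in> space M. \<exists>x\<in>F. \<forall>(h, c)\<in>L. ereal (h x) \<le> c \<xi>} \<in> sets M"
proof -
  have "{\<xi> \<in> space M. \<exists>x\<in>F. \<forall>(h, c)\<in>L. ereal (h x) \<le> c \<xi>} =
    (\<Union>n::nat. {\<xi> \<in> space M. \<exists>x\<in>F \<inter> cball 0 (real n). \<forall>(h, c)\<in>L. ereal (h x) \<le> c \<xi>})"
    using real_arch_simple by fastforce
  also have "\<dots> \<in> sets M"
    using assms by (intro sets.countable_UN subsetI)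
      (auto intro!: measurable_feasible_compact closed_Int_compact)
  finally show ?thesis .
qed

text \<open>Bounds with values in \<open>ereal\<close> keep the argmin in the same form when the infimum is
  infinite: \<open>-\<infinity>\<close> makes the set empty, as it should be.\<close>

lemma measurable_tie_break:
  fixes F :: "'b::euclidean_space set"
  assumes "closed F" "finite L" "\<And>h c. (h, c) \<in> L \<Longrightarrow> continuous_on UNIV h"
    and "\<And>h c. (h, c) \<in> L \<Longrightarrow> c \<in> borel_measurable M"
    and "\<And>t. t \<in> set ts \<Longrightarrow> continuous_on UNIV t" "closed F'"
  shows "{\<xi> \<in> space M. tie_break ts {x \<in> F. \<forall>(h, c)\<in>L. ereal (h x) \<le> c \<xi>} \<inter> F' \<noteq> {}} \<in> sets M"
  using assms(2-5)
proof (induction ts arbitrary: L)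
  case Nil
  have "closed (F \<inter> F')" using assms by auto
  from measurable_feasible[OF this Nil(1-3)] show ?case
    by (rule back_subst[where P="\<lambda>A. A \<in> sets M"]) auto
next
  case (Cons t ts)
  define G where "G \<xi> = {x \<in> F. \<forall>(h, c)\<in>L. ereal (h x) \<le> c \<xi>}" for \<xi>
  define V where "V \<xi> = (INF x\<in>G \<xi>. ereal (t x))" for \<xi>
  \<comment> \<open>Minimising \<open>t\<close> amounts to one more constraint, with the optimal
    value \<open>V\<close> as its bound. Once \<open>V\<close> is measurable, the induction
    hypothesis applies to the enlarged \<open>L\<close>.\<close>
  have argmin: "{x. is_arg_min t (\<lambda>y. y \<in> G \<xi>) x} =
      {x \<in> F. \<forall>(h, c)\<in>insert (t, V) L. ereal (h x) \<le> c \<xi>}" for \<xi>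
  proof (rule set_eqI)
    fix x
    have "ereal (t x) \<le> V \<xi> \<longleftrightarrow> (\<forall>y\<in>G \<xi>. t x \<le> t y)" by (simp add: V_def le_INF_iff)
    moreover have "x \<in> {x \<in> F. \<forall>(h, c)\<in>insert (t, V) L. ereal (h x) \<le> c \<xi>} \<longleftrightarrow>
        x \<in> G \<xi> \<and> ereal (t x) \<le> V \<xi>"
      by (auto simp: G_def)
    ultimately show "x \<in> {x. is_arg_min t (\<lambda>y. y \<in> G \<xi>) x} \<longleftrightarrow>
        x \<in> {x \<in> F. \<forall>(h, c)\<in>insert (t, V) L. ereal (h x) \<le> c \<xi>}"
      by (auto simp: is_arg_min_def not_less)
  qed
  have V: "V \<in> borel_measurable M"
  proof (rule borel_measurableI_less)
    fix y :: ereal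
    \<comment> \<open>The optimal value is below \<open>y\<close> iff the level \<open>q\<close> of
      \<open>t\<close> is attainable for some rational \<open>q\<close> below \<open>y\<close>: a
      countable union of feasibility events.\<close>
    have V_less: "V \<xi> < y \<longleftrightarrow> (\<exists>q\<in>\<rat>. ereal q < y \<and>
        (\<exists>x\<in>F. \<forall>(h, c)\<in>insert (t, \<lambda>_. ereal q) L. ereal (h x) \<le> c \<xi>))" for \<xi>
    proof
      assume "V \<xi> < y"
      then obtain x where x: "x \<in> G \<xi>" "ereal (t x) < y" unfolding V_def INF_less_iff by blast
      then obtain r where r: "ereal (t x) < ereal r" "ereal r < y" using ereal_dense2 by blast
      then obtain q where q: "q \<in> \<rat>" "t x < q" "q < r" using Rats_dense_in_real[of "t x" r] by auto
      then have "ereal q < y" using r(2) by (metis less_ereal.simps(1) order_less_trans)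
      then show "\<exists>q\<in>\<rat>. ereal q < y \<and>
        (\<exists>x\<in>F. \<forall>(h, c)\<in>insert (t, \<lambda>_. ereal q) L. ereal (h x) \<le> c \<xi>)"
        using x(1) q by (auto simp: G_def intro!: bexI[of _ q] bexI[of _ x])
    next
      assume "\<exists>q\<in>\<rat>. ereal q < y \<and>
        (\<exists>x\<in>F. \<forall>(h, c)\<in>insert (t, \<lambda>_. ereal q) L. ereal (h x) \<le> c \<xi>)"
      then obtain q x where "ereal q < y" "x \<in> G \<xi>" "t x \<le> q" by (auto simp: G_def)
      then show "V \<xi> < y" unfolding V_def INF_less_iff
        by (meson ereal_less_eq(3) order_le_less_trans)
    qed
    have "{\<xi> \<in> space M. \<exists>x\<in>F. \<forall>(h, c)\<in>insert (t, \<lambda>_. ereal q) L. ereal (h x) \<le> c \<xi>}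
        \<in> sets M" for q
      using Cons.prems by (intro measurable_feasible assms(1)) auto
    then show "{\<xi> \<in> space M. V \<xi> < y} \<in> sets M"
      unfolding V_less
      by (intro sets.sets_Collect_countable_Ex'[OF _ countable_rat]
          sets.sets_Collect_conj[OF _ sets.sets_Collect_const])
  qed
  have "{\<xi> \<in> space M. tie_break ts {x \<in> F. \<forall>(h, c)\<in>insert (t, V) L. ereal (h x) \<le> c \<xi>} \<inter> F' \<noteq> {}} \<in> sets M"
    using Cons.prems V by (intro Cons.IH) auto
  then show ?case by (simp only: tie_break.simps argmin[symmetric] G_def[symmetric])
qed

text \<open>Where \<open>G\<close> is a singleton, \<open>X\<close> lies in \<open>F\<close> exactly
  if \<open>G\<close> meets \<open>F\<close>; the constant \<open>d\<close> covers the points where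
  \<open>G\<close> is empty.\<close>

lemma measurable_unique_selection:
  fixes X :: "'m \<Rightarrow> 'b::topological_space"
  assumes "\<And>F. closed F \<Longrightarrow> {\<xi> \<in> space M. G \<xi> \<inter> F \<noteq> {}} \<in> sets M"
    and "\<And>\<xi>. \<xi> \<in> space M \<Longrightarrow> G \<xi> \<noteq> {} \<Longrightarrow> G \<xi> = {X \<xi>}"
    and "\<And>\<xi>. \<xi> \<in> space M \<Longrightarrow> G \<xi> = {} \<Longrightarrow> X \<xi> = d"
  shows "X \<in> borel_measurable M"
  unfolding borel_eq_closed
proof (rule measurable_measure_of)
  fix F :: "'b set" assume "F \<in> Collect closed"
  then have "closed F" by simp
  have "X -` F \<inter> space M = {\<xi> \<in> space M. G \<xi> \<inter> F \<noteq> {}} \<union>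
      (if d \<in> F then space M - {\<xi> \<in> space M. G \<xi> \<inter> UNIV \<noteq> {}} else {})"
  proof (rule set_eqI)
    fix \<xi>
    show "\<xi> \<in> X -` F \<inter> space M \<longleftrightarrow> \<xi> \<in> {\<xi> \<in> space M. G \<xi> \<inter> F \<noteq> {}} \<union>
      (if d \<in> F then space M - {\<xi> \<in> space M. G \<xi> \<inter> UNIV \<noteq> {}} else {})"
    proof (cases "\<xi> \<in> space M")
      case True
      then show ?thesis using assms(2,3)[OF True] by (cases "G \<xi> = {}") simp_all
    qed simp
  qed
  also have "\<dots> \<in> sets M" using assms(1)[OF \<open>closed F\<close>] assms(1)[OF closed_UNIV] by auto
  finally show "X -` F \<inter> space M \<in> sets M" .
qed auto

section \<open>Sampling bounds\<close>

text \<open>Fubini: with the coordinates outside \<open>B\<close> fixed, the section of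
  \<open>E\<close> lies in a box with side \<open>T\<close>, of measure at most \<open>q\<close> to
  the power \<open>card B\<close>. The set \<open>T\<close> may vary with the fixed
  coordinates.\<close>

lemma (in prob_space) measure_PiM_le_power:
  assumes "finite I" "B \<subseteq> I" and E: "E \<in> sets (Pi\<^sub>M I (\<lambda>_. M))" and "0 \<le> q"
    and fibre: "\<And>\<xi>. \<xi> \<in> E \<Longrightarrow> \<exists>T\<in>sets M. measure M T \<le> q \<and>
      (\<forall>\<xi>'\<in>E. (\<forall>j\<in>I - B. \<xi>' j = \<xi> j) \<longrightarrow> (\<forall>j\<in>B. \<xi>' j \<in> T))"
  shows "measure (Pi\<^sub>M I (\<lambda>_. M)) E \<le> q ^ card B"
proof -
  let ?A = "I - B"
  interpret PS: product_sigma_finite "\<lambda>_. M"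
    by (intro product_sigma_finite.intro sigma_finite_measure_axioms)
  interpret PA: prob_space "Pi\<^sub>M ?A (\<lambda>_. M)" by (intro prob_space_PiM prob_space_axioms)
  interpret PI: prob_space "Pi\<^sub>M I (\<lambda>_. M)" by (intro prob_space_PiM prob_space_axioms)
  have I: "?A \<union> B = I" "finite B" using assms(1,2) finite_subset by auto
  let ?sec = "\<lambda>x. (\<lambda>y. merge ?A B (x, y)) -` E \<inter> space (Pi\<^sub>M B (\<lambda>_. M))"
  have sec: "emeasure (Pi\<^sub>M B (\<lambda>_. M)) (?sec x) \<le> ennreal (q ^ card B)" for x
  proof (cases "?sec x = {}")
    case False
    \<comment> \<open>Any one point of the section serves as reference; its \<open>T\<close> covers
      the whole section.\<close>
    then obtain y where y: "merge ?A B (x, y) \<in> E" by blast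
    obtain T where T: "T \<in> sets M" "measure M T \<le> q"
      and sub: "\<And>\<xi>'. \<xi>' \<in> E \<Longrightarrow> \<forall>j\<in>?A. \<xi>' j = merge ?A B (x, y) j \<Longrightarrow> \<forall>j\<in>B. \<xi>' j \<in> T"
      using fibre[OF y] by blast
    have "?sec x \<subseteq> Pi\<^sub>E B (\<lambda>_. T)"
    proof
      fix z assume z: "z \<in> ?sec x"
      then have "\<forall>j\<in>B. merge ?A B (x, z) j \<in> T" by (intro sub) (auto simp: merge_def)
      then show "z \<in> Pi\<^sub>E B (\<lambda>_. T)"
        using z by (auto simp: merge_def space_PiM PiE_def)
    qed
    then have "emeasure (Pi\<^sub>M B (\<lambda>_. M)) (?sec x) \<le> emeasure (Pi\<^sub>M B (\<lambda>_. M)) (Pi\<^sub>E B (\<lambda>_. T))"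
      by (intro emeasure_mono sets_PiM_I_finite I T)
    also have "\<dots> = ennreal (measure M T) ^ card B"
      using T(1) I(2) by (simp add: PS.emeasure_PiM emeasure_eq_measure)
    also have "\<dots> \<le> ennreal (q ^ card B)"
      using T(2) by (simp add: ennreal_power) (intro ennreal_leI power_mono, auto)
    finally show ?thesis .
  qed simp
  have "emeasure (Pi\<^sub>M I (\<lambda>_. M)) E = (\<integral>\<^sup>+x. emeasure (Pi\<^sub>M B (\<lambda>_. M)) (?sec x) \<partial>Pi\<^sub>M ?A (\<lambda>_. M))"
    using PS.emeasure_fold_integral[of ?A B E] E assms(1) I by auto
  also have "\<dots> \<le> (\<integral>\<^sup>+x. ennreal (q ^ card B) \<partial>Pi\<^sub>M ?A (\<lambda>_. M))"
    by (intro nn_integral_mono sec)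
  also have "\<dots> = ennreal (q ^ card B)" by (simp add: PA.emeasure_space_1)
  finally show ?thesis using \<open>0 \<le> q\<close> by (simp add: PI.emeasure_eq_measure)
qed

text \<open>Grouped by cardinality, each of the n+1 sizes contributes at most b/(n+1); sizes above
  \<open>card A\<close> contribute nothing.\<close>

lemma sum_subsets_inverse_choose_le:
  assumes "finite A" "0 \<le> (b::real)"
  shows "(\<Sum>J | J \<subseteq> A \<and> card J \<le> n. b / (real (n + 1) * real (card A choose card J))) \<le> b"
proof -
  have "{J. J \<subseteq> A \<and> card J \<le> n} = (\<Union>s\<in>{..n}. {J. J \<subseteq> A \<and> card J = s})" by auto
  then have "(\<Sum>J | J \<subseteq> A \<and> card J \<le> n. b / (real (n + 1) * real (card A choose card J))) =
      (\<Sum>s\<in>{..n}. \<Sum>J | J \<subseteq> A \<and> card J = s. b / (real (n + 1) * real (card A choose card J)))"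
    using assms(1) by (simp only:) (intro sum.UNION_disjoint, auto)
  also have "\<dots> = (\<Sum>s\<in>{..n}. real (card A choose s) * (b / (real (n + 1) * real (card A choose s))))"
    using assms(1) by (intro sum.cong) (auto simp: n_subsets)
  also have "\<dots> \<le> (\<Sum>s\<in>{..n}. b / real (n + 1))"
  proof (intro sum_mono)
    fix s
    show "real (card A choose s) * (b / (real (n + 1) * real (card A choose s))) \<le> b / real (n + 1)"
      using assms(2) by (cases "card A choose s = 0") simp_all
  qed
  also have "\<dots> = b" by simp
  finally show ?thesis .
qed

text \<open>The equation that \<open>eps\<close> solves: its level makes the acceptance probability
  of the k-s discarded samples match the weight of one retained subset in the union bound.\<close>

lemma one_minus_eps_power:
  assumes "s < k" "b > 0"
  shows "(1 - eps n b k s) ^ (k - s) = b / (real (n + 1) * real (k choose s))"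
proof -
  let ?c = "b / (real (n + 1) * real (k choose s))"
  have "?c > 0" using assms by simp
  have "(1 - eps n b k s) ^ (k - s) = (?c powr (1 / real (k - s))) powr real (k - s)"
    using assms \<open>?c > 0\<close> by (subst powr_realpow) (auto simp: eps_def)
  also have "\<dots> = ?c" using assms \<open>?c > 0\<close> by (simp add: powr_powr)
  finally show ?thesis .
qed

lemma eps_le_1: "eps n b k s \<le> 1"
  by (simp add: eps_def)

lemma borel_measurable_sum_component:
  "(\<lambda>x :: real ^ 'n. \<Sum>l\<in>S. x $ l) \<in> borel_measurable borel"
proof (rule borel_measurable_continuous_onI)
  show "continuous_on UNIV (\<lambda>x :: real ^ 'n. \<Sum>l\<in>S. x $ l)"
    by (intro continuous_on_sum continuous_on_component continuous_on_id)
qed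

section \<open>Constraints imposed by single samples\<close>

definition coalitions_of :: "'n::finite \<Rightarrow> 'n set set" where
  "coalitions_of i = {S \<in> coalitions. i \<in> S}"

definition accepts :: "('n::finite set \<Rightarrow> 'a \<Rightarrow> real) \<Rightarrow> 'n \<Rightarrow> 'a \<Rightarrow> (real ^ 'n) set" where
  "accepts u i \<eta> = {x. \<forall>S\<in>coalitions_of i. u S \<eta> \<le> (\<Sum>l\<in>S. x $ l)}"

text \<open>The program that retains only the samples in \<open>J\<close>, in the form of a base set
  cut by one convex set per sample, as \<open>tie_break_support\<close> expects.\<close>

definition subcore ::
  "('n::finite set \<Rightarrow> 'a \<Rightarrow> real) \<Rightarrow> real \<Rightarrow> ('n \<times> nat) set \<Rightarrow> ('n \<times> nat \<Rightarrow> 'a) \<Rightarrow> (real ^ 'n) set" where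
  "subcore u uN J \<xi> = {x. (\<Sum>l\<in>UNIV. x $ l) = uN} \<inter> (\<Inter>j\<in>J. accepts u (fst j) (\<xi> j))"

text \<open>A maximum is bounded iff all its entries are; \<open>K i \<ge> 1\<close> makes every
  inner maximum range over a nonempty set.\<close>

lemma scenario_core_eq_subcore:
  assumes "\<And>i. K i \<ge> 1"
  shows "scenario_core u uN K \<xi> = subcore u uN (SIGMA i:UNIV. {1..K i}) \<xi>"
proof -
  have "(MAX i\<in>S. MAX k\<in>{1..K i}. u S (\<xi> (i, k))) \<le> a \<longleftrightarrow>
      (\<forall>i\<in>S. \<forall>k\<in>{1..K i}. u S (\<xi> (i, k)) \<le> a)" if "S \<in> coalitions" for S a
  proof -
    have "S \<noteq> {}" using that by (simp add: coalitions_def)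
    moreover have "{1..K i} \<noteq> {}" for i using assms[of i] by simp
    ultimately show ?thesis by simp
  qed
  then show ?thesis
    by (auto simp: scenario_core_def subcore_def accepts_def coalitions_of_def)
qed

lemma convex_accepts:
  fixes u :: "'n::finite set \<Rightarrow> 'a \<Rightarrow> real"
  shows "convex (accepts u i \<eta>)"
proof -
  have "convex {x :: real ^ 'n. u S \<eta> \<le> (\<Sum>l\<in>S. x $ l)}" for S
  proof (rule convexI, clarify)
    fix x y :: "real ^ 'n" and a b :: real
    assume *: "u S \<eta> \<le> (\<Sum>l\<in>S. x $ l)" "u S \<eta> \<le> (\<Sum>l\<in>S. y $ l)" "0 \<le> a" "0 \<le> b" "a + b = 1"
    have "u S \<eta> = a * u S \<eta> + b * u S \<eta>" using *(5) by (metis distrib_right mult_1)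
    also have "\<dots> \<le> a * (\<Sum>l\<in>S. x $ l) + b * (\<Sum>l\<in>S. y $ l)"
      using * by (intro add_mono mult_left_mono) auto
    also have "\<dots> = (\<Sum>l\<in>S. (a *\<^sub>R x + b *\<^sub>R y) $ l)" by (simp add: sum.distrib sum_distrib_left)
    finally show "u S \<eta> \<le> (\<Sum>l\<in>S. (a *\<^sub>R x + b *\<^sub>R y) $ l)" .
  qed
  moreover have "accepts u i \<eta> = (\<Inter>S\<in>coalitions_of i. {x. u S \<eta> \<le> (\<Sum>l\<in>S. x $ l)})"
    by (auto simp: accepts_def)
  ultimately show ?thesis by (simp add: convex_INT)
qed

lemma convex_sum_eq: "convex {x :: real ^ 'n. (\<Sum>l\<in>UNIV. x $ l) = c}"
  by (rule convexI) (simp add: sum.distrib flip: sum_distrib_left distrib_right)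

lemma convex_subcore: "convex (subcore u uN J \<xi>)"
  unfolding subcore_def by (intro convex_Int convex_INT convex_accepts convex_sum_eq)

lemma subcore_mono: "J \<subseteq> J' \<Longrightarrow> subcore u uN J' \<xi> \<subseteq> subcore u uN J \<xi>"
  by (auto simp: subcore_def)

lemma subcore_cong: "(\<And>j. j \<in> J \<Longrightarrow> \<xi> j = \<xi>' j) \<Longrightarrow> subcore u uN J \<xi> = subcore u uN J \<xi>'"
  by (simp add: subcore_def)

section \<open>Violation probabilities\<close>

locale uncertain_game = prob_space P for P :: "'a measure" +
  fixes u :: "'n::finite set \<Rightarrow> 'a \<Rightarrow> real" and uN :: real
  assumes u_measurable: "S \<in> coalitions \<Longrightarrow> u S \<in> borel_measurable P"
begin

definition viol :: "'n set set \<Rightarrow> real ^ 'n \<Rightarrow> real" where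
  "viol \<S> x = measure P {\<eta> \<in> space P. \<exists>S\<in>\<S>. (\<Sum>l\<in>S. x $ l) < u S \<eta>}"

lemma sets_viol: "\<S> \<subseteq> coalitions \<Longrightarrow> {\<eta> \<in> space P. \<exists>S\<in>\<S>. c S < u S \<eta>} \<in> sets P"
  by (intro sets.sets_Collect_finite_Ex borel_measurable_less) (auto simp: u_measurable)

text \<open>Violation is a jointly measurable event in allocation and sample, and the measure of its
  sections depends measurably on the allocation.\<close>

lemma measurable_viol:
  assumes "\<S> \<subseteq> coalitions"
  shows "viol \<S> \<in> borel_measurable borel"
proof -
  define Q where "Q = {p \<in> space (borel \<Otimes>\<^sub>M P). \<exists>S\<in>\<S>. (\<Sum>l\<in>S. fst p $ l) < u S (snd p)}"
  have "(\<lambda>p. \<Sum>l\<in>S. (fst p :: real ^ 'n) $ l) \<in> borel_measurable (borel \<Otimes>\<^sub>M P)" for S :: "'n set"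
    by (rule measurable_compose[OF measurable_fst borel_measurable_sum_component])
  moreover have "(\<lambda>p. u S (snd p)) \<in> borel_measurable (borel \<Otimes>\<^sub>M P)" if "S \<in> \<S>" for S
    using u_measurable that assms by (intro measurable_compose[OF measurable_snd]) auto
  ultimately have "Q \<in> sets (borel \<Otimes>\<^sub>M P)"
    unfolding Q_def by (intro sets.sets_Collect_finite_Ex borel_measurable_less) auto
  then have "(\<lambda>x. emeasure P (Pair x -` Q)) \<in> borel_measurable borel"
    by (rule measurable_emeasure_Pair)
  moreover have "Pair x -` Q = {\<eta> \<in> space P. \<exists>S\<in>\<S>. (\<Sum>l\<in>S. x $ l) < u S \<eta>}" for x
    by (auto simp: Q_def space_pair_measure)
  ultimately show ?thesis unfolding viol_def[abs_def] measure_def by simp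
qed

lemma sets_accepts: "{\<eta> \<in> space P. x \<in> accepts u i \<eta>} \<in> sets P"
  unfolding accepts_def mem_Collect_eq
  by (intro sets.sets_Collect_finite_All borel_measurable_le)
    (auto simp: u_measurable coalitions_of_def)

lemma prob_accepts: "prob {\<eta> \<in> space P. x \<in> accepts u i \<eta>} = 1 - viol (coalitions_of i) x"
proof -
  have "space P - {\<eta> \<in> space P. x \<in> accepts u i \<eta>} =
      {\<eta> \<in> space P. \<exists>S\<in>coalitions_of i. (\<Sum>l\<in>S. x $ l) < u S \<eta>}"
    by (auto simp: accepts_def not_le)
  then show ?thesis using prob_compl[OF sets_accepts[of x i]] by (simp add: viol_def)
qed

text \<open>Every coalition is nonempty, hence counted for at least one of its members; then a union
  bound.\<close>

lemma violation_le_sum: "violation P u x \<le> (\<Sum>i\<in>UNIV. viol (coalitions_of i) x)"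
proof -
  have "{\<eta> \<in> space P. \<exists>S\<in>coalitions. (\<Sum>l\<in>S. x $ l) < u S \<eta>} =
      (\<Union>i\<in>UNIV. {\<eta> \<in> space P. \<exists>S\<in>coalitions_of i. (\<Sum>l\<in>S. x $ l) < u S \<eta>})"
    by (fastforce simp: coalitions_of_def coalitions_def)
  then show ?thesis unfolding violation_def viol_def
    by (simp only:) (intro measure_UNION_le sets_viol, auto simp: coalitions_of_def)
qed

section \<open>Reduced programs as random objects\<close>

lemma measurable_component_compose:
  assumes "S \<in> coalitions" "j \<in> I"
  shows "(\<lambda>\<xi>. u S (\<xi> j)) \<in> borel_measurable (Pi\<^sub>M I (\<lambda>_. P))"
  using assms by (intro measurable_compose[OF measurable_component_singleton] u_measurable)

lemma measurable_tie_break_subcore: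
  assumes "finite J" "J \<subseteq> I" "\<And>t. t \<in> set ts \<Longrightarrow> convex_on UNIV t" "closed F"
  shows "{\<xi> \<in> space (Pi\<^sub>M I (\<lambda>_. P)). tie_break ts (subcore u uN J \<xi>) \<inter> F \<noteq> {}}
    \<in> sets (Pi\<^sub>M I (\<lambda>_. P))"
proof -
  \<comment> \<open>Negation turns the lower bounds on coalition sums into the form
    \<open>h x \<le> c \<xi>\<close>.\<close>
  define L where "L = (\<lambda>(j, S). (\<lambda>x :: real ^ 'n. - (\<Sum>l\<in>S. x $ l),
      \<lambda>\<xi>. ereal (- u S (\<xi> j)))) ` (SIGMA j:J. coalitions_of (fst j))"
  have "finite L" using assms(1) by (auto simp: L_def)
  moreover have "closed {x :: real ^ 'n. (\<Sum>l\<in>UNIV. x $ l) = uN}"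
    by (intro closed_Collect_eq continuous_intros)
  moreover have "continuous_on UNIV h" if "(h, c) \<in> L" for h c
    using that by (auto simp: L_def intro!: continuous_intros)
  moreover have "c \<in> borel_measurable (Pi\<^sub>M I (\<lambda>_. P))" if "(h, c) \<in> L" for h c
    using that assms(2)
    by (auto simp: L_def coalitions_of_def intro!: borel_measurable_ereal borel_measurable_uminus
        measurable_component_compose)
  moreover have "continuous_on UNIV t" if "t \<in> set ts" for t
    using assms(3)[OF that] by (intro convex_on_continuous) auto
  moreover have "subcore u uN J \<xi> =
      {x \<in> {x. (\<Sum>l\<in>UNIV. x $ l) = uN}. \<forall>(h, c)\<in>L. ereal (h x) \<le> c \<xi>}" for \<xi>
    by (auto simp: subcore_def accepts_def L_def)
  ultimately show ?thesis
    using assms(4) by (simp only:) (intro measurable_tie_break, auto)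
qed

text \<open>Fixing the coordinates outside \<open>B\<close> fixes \<open>X\<close>. Each coordinate
  in \<open>B\<close> must then fall into the set of samples accepting \<open>X\<close>, whose
  probability is one minus the violation and hence below 1 - \<epsilon>.\<close>

lemma measure_undetected_le:
  fixes X :: "('j \<Rightarrow> 'a) \<Rightarrow> real ^ 'n" and i :: 'n
  assumes "finite I" "B \<subseteq> I" and X: "X \<in> borel_measurable (Pi\<^sub>M I (\<lambda>_. P))"
    and dep: "\<And>\<xi> \<xi>'. (\<And>j. j \<in> I - B \<Longrightarrow> \<xi> j = \<xi>' j) \<Longrightarrow> X \<xi> = X \<xi>'" and "\<epsilon> \<le> 1"
  defines "E \<equiv> {\<xi> \<in> space (Pi\<^sub>M I (\<lambda>_. P)).
      (\<forall>j\<in>B. X \<xi> \<in> accepts u i (\<xi> j)) \<and> \<epsilon> < viol (coalitions_of i) (X \<xi>)}"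
  shows "E \<in> sets (Pi\<^sub>M I (\<lambda>_. P))"
    and "measure (Pi\<^sub>M I (\<lambda>_. P)) E \<le> (1 - \<epsilon>) ^ card B"
proof -
  have "(\<lambda>\<xi>. \<Sum>l\<in>S. X \<xi> $ l) \<in> borel_measurable (Pi\<^sub>M I (\<lambda>_. P))" for S
    by (rule measurable_compose[OF X borel_measurable_sum_component])
  then have "{\<xi> \<in> space (Pi\<^sub>M I (\<lambda>_. P)). X \<xi> \<in> accepts u i (\<xi> j)} \<in> sets (Pi\<^sub>M I (\<lambda>_. P))"
    if "j \<in> B" for j
    using that assms(2) unfolding accepts_def mem_Collect_eq
    by (intro sets.sets_Collect_finite_All borel_measurable_le measurable_component_compose)
      (auto simp: coalitions_of_def)
  moreover have "(\<lambda>\<xi>. viol (coalitions_of i) (X \<xi>)) \<in> borel_measurable (Pi\<^sub>M I (\<lambda>_. P))"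
    by (intro measurable_compose[OF X] measurable_viol) (auto simp: coalitions_of_def)
  ultimately show E: "E \<in> sets (Pi\<^sub>M I (\<lambda>_. P))"
    unfolding E_def using finite_subset[OF assms(2,1)]
    by (intro sets.sets_Collect_conj sets.sets_Collect_finite_All borel_measurable_less) auto
  show "measure (Pi\<^sub>M I (\<lambda>_. P)) E \<le> (1 - \<epsilon>) ^ card B"
  proof (rule measure_PiM_le_power[OF assms(1,2) E])
    fix \<xi> assume "\<xi> \<in> E"
    let ?T = "{\<eta> \<in> space P. X \<xi> \<in> accepts u i \<eta>}"
    have "prob ?T \<le> 1 - \<epsilon>" using \<open>\<xi> \<in> E\<close> unfolding prob_accepts by (simp add: E_def)
    moreover have "\<forall>j\<in>B. \<xi>' j \<in> ?T" if \<xi>': "\<xi>' \<in> E" "\<forall>j\<in>I - B. \<xi>' j = \<xi> j" for \<xi>'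
    proof
      fix j assume "j \<in> B"
      have "X \<xi>' = X \<xi>" using \<xi>'(2) by (intro dep) auto
      moreover have "\<xi>' j \<in> space P"
        using \<xi>'(1) \<open>j \<in> B\<close> assms(2) by (auto simp: E_def space_PiM)
      ultimately show "\<xi>' j \<in> ?T" using \<xi>'(1) \<open>j \<in> B\<close> by (auto simp: E_def)
    qed
    ultimately show "\<exists>T\<in>sets P. prob T \<le> 1 - \<epsilon> \<and>
        (\<forall>\<xi>'\<in>E. (\<forall>j\<in>I - B. \<xi>' j = \<xi> j) \<longrightarrow> (\<forall>j\<in>B. \<xi>' j \<in> T))"
      using sets_accepts by blast
  qed (use \<open>\<epsilon> \<le> 1\<close> in simp)
qed

text \<open>The constant 0 makes the choice total when a reduced program has no minimiser, without
  spoiling measurability.\<close>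

definition selection ::
  "(real ^ 'n \<Rightarrow> real) list \<Rightarrow> ('n \<times> nat) set \<Rightarrow> ('n \<times> nat \<Rightarrow> 'a) \<Rightarrow> real ^ 'n" where
  "selection ts J \<xi> = (if tie_break ts (subcore u uN J \<xi>) = {} then 0
    else SOME x. x \<in> tie_break ts (subcore u uN J \<xi>))"

lemma tie_break_eq_selection:
  assumes "\<And>t. t \<in> set ts \<Longrightarrow> convex_on UNIV t"
    and "x \<in> tie_break (ts @ [\<lambda>z. z \<bullet> z]) (subcore u uN J \<xi>)"
  shows "tie_break (ts @ [\<lambda>z. z \<bullet> z]) (subcore u uN J \<xi>) =
    {selection (ts @ [\<lambda>z. z \<bullet> z]) J \<xi>}"
proof -
  let ?T = "tie_break (ts @ [\<lambda>z. z \<bullet> z]) (subcore u uN J \<xi>)"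
  have "?T = {x}"
    using tie_break_unique[OF assms(1) convex_subcore _ assms(2)] assms(2) by blast
  then show ?thesis by (simp add: selection_def)
qed

lemma measurable_selection:
  assumes "finite J" "J \<subseteq> I" "\<And>t. t \<in> set ts \<Longrightarrow> convex_on UNIV t"
  shows "selection (ts @ [\<lambda>z. z \<bullet> z]) J \<in> borel_measurable (Pi\<^sub>M I (\<lambda>_. P))"
proof (rule measurable_unique_selection)
  show "{\<xi> \<in> space (Pi\<^sub>M I (\<lambda>_. P)).
      tie_break (ts @ [\<lambda>z. z \<bullet> z]) (subcore u uN J \<xi>) \<inter> F \<noteq> {}} \<in> sets (Pi\<^sub>M I (\<lambda>_. P))"
    if "closed F" for F
    using assms that convex_on_inner_self by (intro measurable_tie_break_subcore) auto
qed (use tie_break_eq_selection assms(3) in \<open>blast, simp add: selection_def\<close>)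

text \<open>Agent \<open>i\<close> keeps only the samples in \<open>J\<close>, all others keep everything; the resulting allocation
  is accepted by the discarded samples although it violates the coalitions of \<open>i\<close> too often.\<close>

definition misled ::
  "(real ^ 'n \<Rightarrow> real) list \<Rightarrow> ('n \<Rightarrow> nat) \<Rightarrow> real \<Rightarrow> 'n \<Rightarrow> nat set \<Rightarrow> ('n \<times> nat \<Rightarrow> 'a) set" where
  "misled ts K b i J = {\<xi> \<in> space (multisample P K).
    (\<forall>j\<in>{i} \<times> ({1..K i} - J).
      selection ts ((SIGMA i:UNIV. {1..K i}) - {i} \<times> ({1..K i} - J)) \<xi> \<in> accepts u i (\<xi> j)) \<and>
    eps CARD('n) b (K i) (card J) <
      viol (coalitions_of i) (selection ts ((SIGMA i:UNIV. {1..K i}) - {i} \<times> ({1..K i} - J)) \<xi>)}"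

text \<open>The selected allocation is a function of the retained coordinates only, so
  \<open>measure_undetected_le\<close> applies to the discarded ones, and the calibration of
  \<open>eps\<close> evaluates the power.\<close>

lemma misled_bound:
  assumes "\<And>t. t \<in> set ts \<Longrightarrow> convex_on UNIV t" "0 < b" "J \<subseteq> {1..K i}"
  shows "misled (ts @ [\<lambda>z. z \<bullet> z]) K b i J \<in> sets (multisample P K)"
    and "measure (multisample P K) (misled (ts @ [\<lambda>z. z \<bullet> z]) K b i J)
      \<le> b / (real (CARD('n) + 1) * real (K i choose card J))"
proof -
  let ?I = "SIGMA i:UNIV. {1..K i}" and ?B = "{i} \<times> ({1..K i} - J)"
  let ?X = "selection (ts @ [\<lambda>z. z \<bullet> z]) (?I - ?B)"
  have I: "finite ?I" "?B \<subseteq> ?I" by auto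
  have X: "?X \<in> borel_measurable (Pi\<^sub>M ?I (\<lambda>_. P))"
    using I by (intro measurable_selection assms(1)) auto
  have dep: "?X \<xi> = ?X \<xi>'" if "\<And>j. j \<in> ?I - ?B \<Longrightarrow> \<xi> j = \<xi>' j" for \<xi> \<xi>'
  proof -
    have "subcore u uN (?I - ?B) \<xi> = subcore u uN (?I - ?B) \<xi>'" using that by (rule subcore_cong)
    then show ?thesis by (simp only: selection_def)
  qed
  note bound = measure_undetected_le[OF I X dep eps_le_1]
  show "misled (ts @ [\<lambda>z. z \<bullet> z]) K b i J \<in> sets (multisample P K)"
    unfolding misled_def multisample_def by (rule bound(1))
  have le: "measure (multisample P K) (misled (ts @ [\<lambda>z. z \<bullet> z]) K b i J)
      \<le> (1 - eps CARD('n) b (K i) (card J)) ^ card ?B"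
    unfolding misled_def multisample_def by (rule bound(2))
  have "finite J" using assms(3) finite_subset by blast
  then have B: "card ?B = K i - card J" using assms(3)
    by (simp add: card_cartesian_product_singleton card_Diff_subset)
  show "measure (multisample P K) (misled (ts @ [\<lambda>z. z \<bullet> z]) K b i J)
      \<le> b / (real (CARD('n) + 1) * real (K i choose card J))"
  proof (cases "card J < K i")
    case True
    then show ?thesis using le assms(2) by (simp only: B one_minus_eps_power)
  next
    \<comment> \<open>With all samples retained \<open>eps\<close> is 1, a level that no probability
      exceeds.\<close>
    case False
    then have "misled (ts @ [\<lambda>z. z \<bullet> z]) K b i J = {}"
      by (auto simp: misled_def eps_def viol_def not_less)
    then show ?thesis using assms(2) by simp
  qed
qed

text \<open>Union bound over the retained subsets, whose weights add up to at most
  \<open>b\<close>.\<close>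

lemma measure_Union_misled_le:
  fixes K :: "'n \<Rightarrow> nat" and i :: 'n
  assumes "\<And>t. t \<in> set ts \<Longrightarrow> convex_on UNIV t" "0 < b"
  defines "W \<equiv> (\<Union>J\<in>{J. J \<subseteq> {1..K i} \<and> card J \<le> CARD('n)}. misled (ts @ [\<lambda>z. z \<bullet> z]) K b i J)"
  shows "W \<in> sets (multisample P K)" and "measure (multisample P K) W \<le> b"
proof -
  have fin: "finite {J. J \<subseteq> {1..K i} \<and> card J \<le> CARD('n)}" by simp
  note misled = misled_bound[where ts=ts and b=b and K=K and i=i, OF assms(1,2)]
  show "W \<in> sets (multisample P K)" unfolding W_def
    using misled(1) by (intro sets.finite_UN fin) auto
  have "measure (multisample P K) W \<le> (\<Sum>J | J \<subseteq> {1..K i} \<and> card J \<le> CARD('n).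
      measure (multisample P K) (misled (ts @ [\<lambda>z. z \<bullet> z]) K b i J))"
    unfolding W_def using misled(1) by (intro measure_UNION_le fin) auto
  also have "\<dots> \<le> (\<Sum>J | J \<subseteq> {1..K i} \<and> card J \<le> CARD('n).
      b / (real (CARD('n) + 1) * real (card {1..K i} choose card J)))"
    using misled(2) by (intro sum_mono) auto
  also have "\<dots> \<le> b" using assms(2) by (intro sum_subsets_inverse_choose_le) auto
  finally show "measure (multisample P K) W \<le> b" .
qed

text \<open>The allocation \<open>x\<close> also solves the program from which only the samples of
  \<open>i\<close> outside \<open>J\<close> are removed. The removed samples accept
  \<open>x\<close>, so a larger violation would put the multisample into
  \<open>misled\<close>.\<close>

lemma viol_le_eps_if_not_misled:
  fixes K :: "'n \<Rightarrow> nat"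
  defines "I \<equiv> SIGMA i:UNIV. {1..K i}"
  assumes "\<And>t. t \<in> set ts \<Longrightarrow> convex_on UNIV t" and "\<xi> \<in> space (multisample P K)"
    and x: "x \<in> subcore u uN I \<xi>"
    and "J \<subseteq> I" and xJ: "x \<in> tie_break (ts @ [\<lambda>z. z \<bullet> z]) (subcore u uN J \<xi>)"
    and "\<xi> \<notin> misled (ts @ [\<lambda>z. z \<bullet> z]) K b i (J `` {i})"
  shows "viol (coalitions_of i) x \<le> eps CARD('n) b (K i) (card (J `` {i}))"
proof -
  let ?B = "{i} \<times> ({1..K i} - J `` {i})"
  \<comment> \<open>The program on \<open>I - ?B\<close> lies between those on \<open>J\<close> and
    \<open>I\<close>: \<open>x\<close> is optimal under the fewer constraints of \<open>J\<close>
    and feasible under all of \<open>I\<close>, hence optimal in between.\<close>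
  have "J \<subseteq> I - ?B" using \<open>J \<subseteq> I\<close> by auto
  then have "x \<in> tie_break (ts @ [\<lambda>z. z \<bullet> z]) (subcore u uN (I - ?B) \<xi>)"
    using x xJ subcore_mono[of J "I - ?B" u uN \<xi>] subcore_mono[of "I - ?B" I u uN \<xi>]
    by (intro tie_break_antimono[OF xJ]) auto
  from tie_break_eq_selection[OF assms(2) this] this
  have "selection (ts @ [\<lambda>z. z \<bullet> z]) (I - ?B) \<xi> = x" by simp
  moreover have "\<forall>j\<in>?B. x \<in> accepts u i (\<xi> j)"
    using x by (fastforce simp: subcore_def I_def)
  ultimately show ?thesis using assms(3,7) by (auto simp: misled_def I_def not_less)
qed

lemma violation_le_eps_star:
  fixes K :: "'n \<Rightarrow> nat"
  defines "I \<equiv> SIGMA i:UNIV. {1..K i}"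
  assumes "\<And>t. t \<in> set ts \<Longrightarrow> convex_on UNIV t" and "\<xi> \<in> space (multisample P K)"
    and x: "tie_break ts (subcore u uN I \<xi>) = {x}"
    and W: "\<And>i J. J \<subseteq> {1..K i} \<Longrightarrow> card J \<le> CARD('n) \<Longrightarrow>
      \<xi> \<notin> misled (ts @ [\<lambda>z. z \<bullet> z]) K (\<beta>s i) i J"
  shows "violation P u x \<le> eps_star \<beta>s K"
proof -
  let ?ts = "ts @ [\<lambda>z. z \<bullet> z]"
  have I: "finite I" by (simp add: I_def)
  have cv: "convex_on UNIV t" if "t \<in> set ?ts" for t
    using that assms(2) convex_on_inner_self by auto
  \<comment> \<open>A further criterion cannot change a set of minimisers that is already a
    singleton.\<close>
  have "tie_break ?ts (subcore u uN I \<xi>) = {x}"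
    by (auto simp: tie_break_append x is_arg_min_def)
  then have "x \<in> tie_break ?ts ({x. (\<Sum>l\<in>UNIV. x $ l) = uN} \<inter> (\<Inter>j\<in>I. accepts u (fst j) (\<xi> j)))"
    by (simp add: subcore_def)
  from tie_break_support[OF cv convex_sum_eq I convex_accepts this]
  obtain J where J: "J \<subseteq> I" "card J \<le> CARD('n)" "x \<in> tie_break ?ts (subcore u uN J \<xi>)"
    unfolding subcore_def by auto
  define s where "s i = card (J `` {i})" for i
  have Ji: "J `` {i} \<subseteq> {1..K i}" for i using J(1) by (auto simp: I_def)
  \<comment> \<open>Splitting the support set by agent gives sizes that add up to
    \<open>card J\<close>, so \<open>s\<close> is admissible in the maximum defining
    \<open>eps_star\<close>.\<close>
  have "J = (SIGMA i:UNIV. J `` {i})" by auto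
  then have "card J = (\<Sum>i\<in>UNIV. s i)"
    using card_SigmaI[of UNIV "\<lambda>i. J `` {i}"] Ji finite_subset unfolding s_def
    by (metis finite finite_atLeastAtMost)
  then have sum_s: "(\<Sum>i\<in>UNIV. s i) \<le> CARD('n)" using J(2) by simp
  have s_le: "s i \<le> K i" for i using card_mono[OF _ Ji[of i]] by (simp add: s_def)
  have "x \<in> subcore u uN I \<xi>" using x unfolding tie_break_eq_lex by blast
  moreover have "s i \<le> CARD('n)" for i
    using sum_s member_le_sum[of i UNIV s] by simp
  ultimately have "viol (coalitions_of i) x \<le> eps CARD('n) (\<beta>s i) (K i) (s i)" for i
    using viol_le_eps_if_not_misled[OF assms(2,3) _ _ J(3)] J(1) W[OF Ji] unfolding I_def s_def
    by blast
  then have "violation P u x \<le> (\<Sum>i\<in>UNIV. eps CARD('n) (\<beta>s i) (K i) (s i))"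
    by (intro order_trans[OF violation_le_sum] sum_mono)
  also have "\<dots> \<le> eps_star \<beta>s K"
  proof -
    have "{s. (\<Sum>i\<in>UNIV. s i) \<le> CARD('n) \<and> (\<forall>i. s i \<le> K i)} \<subseteq> (\<Pi>\<^sub>E i\<in>UNIV. {..K i})" by auto
    then have "finite {s. (\<Sum>i\<in>UNIV. s i) \<le> CARD('n) \<and> (\<forall>i. s i \<le> K i)}"
      by (rule finite_subset) (simp add: finite_PiE)
    then show ?thesis unfolding eps_star_def using sum_s s_le
      by (intro Max_ge) (auto simp: setcompr_eq_image)
  qed
  finally show ?thesis .
qed

end

section \<open>Confidence bound for the optimal allocation\<close>

theorem corollary1:
  fixes P :: "'a measure"
    and u :: "'n::finite set \<Rightarrow> 'a \<Rightarrow> real"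
    and uN :: real
    and K :: "'n \<Rightarrow> nat"
    and \<beta> :: real
    and \<beta>s :: "'n \<Rightarrow> real"
    and f :: "real ^ 'n \<Rightarrow> real"
    and ts :: "(real ^ 'n \<Rightarrow> real) list"
    and xstar :: "('n \<times> nat \<Rightarrow> 'a) \<Rightarrow> real ^ 'n"
  assumes "prob_space P"
    and "\<And>S. S \<in> coalitions \<Longrightarrow> u S \<in> borel_measurable P"
    and "\<And>i. K i \<ge> 1"
    and "\<And>\<xi>. \<xi> \<in> space (multisample P K) \<Longrightarrow> scenario_core u uN K \<xi> \<noteq> {}"
    and "0 < \<beta>" and "\<beta> < 1"
    and "\<And>i. \<beta>s i > 0" and "(\<Sum>i\<in>UNIV. \<beta>s i) = \<beta>"
    and "convex_on UNIV f"
    and "\<And>t. t \<in> set ts \<Longrightarrow> convex_on UNIV t"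
    and "\<And>\<xi>. \<xi> \<in> space (multisample P K) \<Longrightarrow>
           minimisers f ts (scenario_core u uN K \<xi>) = {xstar \<xi>}"
  shows "measure (multisample P K)
           {\<xi> \<in> space (multisample P K). violation P u (xstar \<xi>) \<le> eps_star \<beta>s K} \<ge> 1 - \<beta>"
proof -
  interpret uncertain_game P u uN
    using assms(1,2) by (simp add: uncertain_game_def uncertain_game_axioms_def)
  interpret MS: prob_space "multisample P K"
    unfolding multisample_def by (intro prob_space_PiM prob_space_axioms)
  let ?I = "SIGMA i:UNIV. {1..K i}" and ?ts = "f # ts"
  have cv: "convex_on UNIV t" if "t \<in> set ?ts" for t using that assms(9,10) by auto
  have x: "tie_break ?ts (subcore u uN ?I \<xi>) = {xstar \<xi>}" if "\<xi> \<in> space (multisample P K)" for \<xi>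
    using assms(11)[OF that]
    by (simp add: minimisers_def scenario_core_eq_subcore[OF assms(3)])
  \<comment> \<open>Since \<open>measure\<close> is 0 outside the sigma-algebra, the event in the
    conclusion has to be shown measurable; uniqueness of the minimiser provides this.\<close>
  have "xstar \<in> borel_measurable (multisample P K)"
  proof (rule measurable_unique_selection)
    show "{\<xi> \<in> space (multisample P K). tie_break ?ts (subcore u uN ?I \<xi>) \<inter> F \<noteq> {}}
        \<in> sets (multisample P K)" if "closed F" for F
      unfolding multisample_def using that cv by (intro measurable_tie_break_subcore) auto
  qed (use x in auto)
  then have "(\<lambda>\<xi>. violation P u (xstar \<xi>)) \<in> borel_measurable (multisample P K)"
    using measurable_compose[OF _ measurable_viol[of coalitions]]
    by (simp add: viol_def violation_def)
  then have good: "{\<xi> \<in> space (multisample P K). violation P u (xstar \<xi>) \<le> eps_star \<beta>s K}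
      \<in> MS.events"
    by (intro borel_measurable_le) auto
  \<comment> \<open>The support set depends on the multisample, so the exceptional event of agent
    \<open>i\<close> has to cover every candidate subset in advance.\<close>
  define W where "W i = (\<Union>J\<in>{J. J \<subseteq> {1..K i} \<and> card J \<le> CARD('n)}.
      misled (?ts @ [\<lambda>z. z \<bullet> z]) K (\<beta>s i) i J)" for i
  have W: "W i \<in> MS.events" "MS.prob (W i) \<le> \<beta>s i" for i
    unfolding W_def using measure_Union_misled_le[where ts="?ts", OF cv assms(7)] by blast+
  have "MS.prob (\<Union>i\<in>UNIV. W i) \<le> (\<Sum>i\<in>UNIV. MS.prob (W i))"
    using W(1) by (intro measure_UNION_le) auto
  also have "\<dots> \<le> \<beta>" unfolding assms(8)[symmetric] by (intro sum_mono W(2))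
  finally have "1 - \<beta> \<le> MS.prob (space (multisample P K) - (\<Union>i\<in>UNIV. W i))"
    using W(1) by (subst MS.prob_compl) auto
  also have "\<dots> \<le> MS.prob {\<xi> \<in> space (multisample P K).
      violation P u (xstar \<xi>) \<le> eps_star \<beta>s K}"
  proof (rule MS.finite_measure_mono[OF _ good], rule subsetI)
    fix \<xi> assume \<xi>: "\<xi> \<in> space (multisample P K) - (\<Union>i\<in>UNIV. W i)"
    then have "violation P u (xstar \<xi>) \<le> eps_star \<beta>s K"
      by (intro violation_le_eps_star[OF cv _ x]) (auto simp: W_def)
    then show "\<xi> \<in> {\<xi> \<in> space (multisample P K). violation P u (xstar \<xi>) \<le> eps_star \<beta>s K}"
      using \<xi> by simp
  qed
  finally show ?thesis .
qed

end
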